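(* Let $a\geq 1$ be an integer and let $\mathbb B$ be a finite structure with finite relational signature. Then $\mathbb B\leq \mathbb C_a$ (that is, $\mathbb B$ pp-constructs the directed cycle $\mathbb C_a$) if and only if for every prime divisor $p$ of $a$ the polymorphism clone $\operatorname{Pol}(\mathbb B)$ does not satisfy $\Sigma_p$.
   Context: Structures have nonempty domains. A primitive positive (pp) formula is a first-order formula built from atomic formulas $R(x_1,\dots,x_n)$, $x\approx y$, and the always-false formula $\bot$ using only conjunction and existential quantification. A structure is a pp-power of $\mathbb A$ if it is isomorphic to a structure with domain $A^n$ for some $n\geq 1$ whose relations are pp-definable in $\mathbb A$ (a $k$-ary relation on $A^n$ being regarded as a $kn$-ary relation on $A$). $\mathbb A$ pp-constructs $\mathbb B$, written $\mathbb A\leq\mathbb B$, if $\mathbb B$ is homomorphically equivalent to a pp-power of $\mathbb A$ (homomorphisms exist in both directions). $\mathbb C_a$ is the digraph with vertex set $\{0,\dots,a-1\}$ and edges $(i,i+1 \bmod a)$; $\mathbb C_1$ is a single loop. $\operatorname{Pol}(\mathbb B)$ is the set of all homomorphisms $\mathbb B^n\to\mathbb B$, $n\geq 1$. For a prime $p$, $\Sigma_p$ is the $p$-cyclic loop condition $f(x_1,x_2,\dots,x_p)\approx f(x_2,\dots,x_p,x_1)$; $\operatorname{Pol}(\mathbb B)$ satisfies $\Sigma_p$ if there is a $p$-ary $f\in\operatorname{Pol}(\mathbb B)$ for which this identity holds for all elements of $B$. *)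

theory Defs
  imports "HOL-Library.NList" "HOL-Computational_Algebra.Primes"
begin

text \<open>
  A relational structure over a signature \<open>Sym\<close> of relation symbols with arities \<open>Ar\<close>.
  Tuples are lists, so a k-ary relation is a subset of \<open>nlists k (Dom A)\<close>.
  The values of \<open>Ar\<close> and \<open>Rel\<close> outside \<open>Sym\<close> carry no meaning.
\<close>

record ('r, 'a) rel_struct =
  Dom :: "'a set"
  Sym :: "'r set"
  Ar :: "'r \<Rightarrow> nat"
  Rel :: "'r \<Rightarrow> 'a list set"

definition is_struct :: "('r, 'a) rel_struct \<Rightarrow> bool" where
  "is_struct A \<longleftrightarrow> Dom A \<noteq> {} \<and> (\<forall>R\<in>Sym A. Rel A R \<subseteq> nlists (Ar A R) (Dom A))"

definition same_signature :: "('r, 'a) rel_struct \<Rightarrow> ('r, 'b) rel_struct \<Rightarrow> bool" where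
  "same_signature A B \<longleftrightarrow> Sym A = Sym B \<and> (\<forall>R\<in>Sym A. Ar A R = Ar B R)"

definition is_hom :: "('r, 'a) rel_struct \<Rightarrow> ('r, 'b) rel_struct \<Rightarrow> ('a \<Rightarrow> 'b) \<Rightarrow> bool" where
  "is_hom A B h \<longleftrightarrow> same_signature A B \<and> h ` Dom A \<subseteq> Dom B \<and>
     (\<forall>R\<in>Sym A. \<forall>t\<in>Rel A R. map h t \<in> Rel B R)"

definition hom_equivalent :: "('r, 'a) rel_struct \<Rightarrow> ('r, 'b) rel_struct \<Rightarrow> bool" where
  "hom_equivalent A B \<longleftrightarrow> (\<exists>h. is_hom A B h) \<and> (\<exists>h. is_hom B A h)"

definition isomorphic :: "('r, 'a) rel_struct \<Rightarrow> ('r, 'b) rel_struct \<Rightarrow> bool" where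
  "isomorphic A B \<longleftrightarrow> same_signature A B \<and>
     (\<exists>h. bij_betw h (Dom A) (Dom B) \<and>
       (\<forall>R\<in>Sym A. \<forall>t\<in>nlists (Ar A R) (Dom A). t \<in> Rel A R \<longleftrightarrow> map h t \<in> Rel B R))"

datatype 'r pp_formula =
    Atom 'r "nat list"
  | Equal nat nat
  | Bot
  | Conj "'r pp_formula" "'r pp_formula"
  | Exi nat "'r pp_formula"

primrec free_vars :: "'r pp_formula \<Rightarrow> nat set" where
  "free_vars (Atom R xs) = set xs"
| "free_vars (Equal x y) = {x, y}"
| "free_vars Bot = {}"
| "free_vars (Conj \<phi> \<psi>) = free_vars \<phi> \<union> free_vars \<psi>"
| "free_vars (Exi x \<phi>) = free_vars \<phi> - {x}"

primrec formula_over :: "('r, 'a) rel_struct \<Rightarrow> 'r pp_formula \<Rightarrow> bool" where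
  "formula_over A (Atom R xs) \<longleftrightarrow> R \<in> Sym A \<and> length xs = Ar A R"
| "formula_over A (Equal x y) \<longleftrightarrow> True"
| "formula_over A Bot \<longleftrightarrow> True"
| "formula_over A (Conj \<phi> \<psi>) \<longleftrightarrow> formula_over A \<phi> \<and> formula_over A \<psi>"
| "formula_over A (Exi x \<phi>) \<longleftrightarrow> formula_over A \<phi>"

primrec sat :: "('r, 'a) rel_struct \<Rightarrow> (nat \<Rightarrow> 'a) \<Rightarrow> 'r pp_formula \<Rightarrow> bool" where
  "sat A s (Atom R xs) \<longleftrightarrow> map s xs \<in> Rel A R"
| "sat A s (Equal x y) \<longleftrightarrow> s x = s y"
| "sat A s Bot \<longleftrightarrow> False"
| "sat A s (Conj \<phi> \<psi>) \<longleftrightarrow> sat A s \<phi> \<and> sat A s \<psi>"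
| "sat A s (Exi x \<phi>) \<longleftrightarrow> (\<exists>a\<in>Dom A. sat A (s(x := a)) \<phi>)"

text \<open>
  The relation \<open>S\<close> is defined by a pp formula whose free variables are among \<open>0, \<dots>, k - 1\<close>.
  The assignment \<open>(!) t\<close> is unspecified outside this range, where it is irrelevant.
\<close>

definition pp_definable :: "('r, 'a) rel_struct \<Rightarrow> nat \<Rightarrow> 'a list set \<Rightarrow> bool" where
  "pp_definable A k S \<longleftrightarrow>
     (\<exists>\<phi>. formula_over A \<phi> \<and> free_vars \<phi> \<subseteq> {..<k} \<and>
        S = {t \<in> nlists k (Dom A). sat A ((!) t) \<phi>})"

text \<open>
  Concatenation turns a k-tuple of elements of \<open>A\<^sup>n\<close> into a \<open>k * n\<close>-tuple of elements of \<open>A\<close>;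
  it is injective on \<open>nlists k (nlists n (Dom A))\<close>.
\<close>

definition is_pp_power :: "('r, 'a) rel_struct \<Rightarrow> ('s, 'c) rel_struct \<Rightarrow> bool" where
  "is_pp_power A P \<longleftrightarrow>
     (\<exists>n\<ge>1. \<exists>Q :: ('s, 'a list) rel_struct.
        is_struct Q \<and> Dom Q = nlists n (Dom A) \<and>
        (\<forall>S\<in>Sym Q. pp_definable A (Ar Q S * n) (concat ` Rel Q S)) \<and>
        isomorphic P Q)"

text \<open>
  The quantified pp-power has elements of type \<open>'a list\<close>. Since every pp-power of \<open>A\<close> is
  isomorphic to one on \<open>nlists n (Dom A)\<close>, this choice of type is no restriction.
\<close>

definition pp_constructs :: "('r, 'a) rel_struct \<Rightarrow> ('s, 'b) rel_struct \<Rightarrow> bool" where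
  "pp_constructs A B \<longleftrightarrow>
     (\<exists>P :: ('s, 'a list) rel_struct. is_struct P \<and> is_pp_power A P \<and> hom_equivalent B P)"

definition dicycle :: "nat \<Rightarrow> (unit, nat) rel_struct" where
  "dicycle a = \<lparr>Dom = {..<a}, Sym = {()}, Ar = (\<lambda>_. 2),
                Rel = (\<lambda>_. {[i, (i + 1) mod a] | i. i < a})\<rparr>"

text \<open>The direct power \<open>A\<^sup>n\<close>, whose relations hold coordinatewise.\<close>

definition struct_power :: "('r, 'a) rel_struct \<Rightarrow> nat \<Rightarrow> ('r, 'a list) rel_struct" where
  "struct_power A n =
     \<lparr>Dom = nlists n (Dom A), Sym = Sym A, Ar = Ar A,
      Rel = (\<lambda>R. {T \<in> nlists (Ar A R) (nlists n (Dom A)).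
                    \<forall>j<n. map (\<lambda>x. x ! j) T \<in> Rel A R})\<rparr>"

text \<open>
  A polymorphism is paired with its arity, because a function on lists does not determine it.
\<close>

definition Pol :: "('r, 'a) rel_struct \<Rightarrow> (nat \<times> ('a list \<Rightarrow> 'a)) set" where
  "Pol B = {(n, f). n \<ge> 1 \<and> is_hom (struct_power B n) B f}"

text \<open>\<open>rotate1\<close> maps \<open>(x\<^sub>1, \<dots>, x\<^sub>p)\<close> to \<open>(x\<^sub>2, \<dots>, x\<^sub>p, x\<^sub>1)\<close>.\<close>

definition Pol_satisfies_cyclic_loop :: "('r, 'a) rel_struct \<Rightarrow> nat \<Rightarrow> bool" where
  "Pol_satisfies_cyclic_loop B p \<longleftrightarrow>
     (\<exists>f. (p, f) \<in> Pol B \<and> (\<forall>x\<in>nlists p (Dom B). f x = f (rotate1 x)))"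

end

theory Submission
  imports Defs
begin

text \<open>If \<open>f\<close> is a cyclic polymorphism of prime arity \<open>p\<close> dividing \<open>a\<close>, then applying \<open>f\<close> to \<open>p\<close>
  equidistant vertices of a closed walk of length \<open>a\<close> produces a closed walk of length \<open>a div p\<close>;
  a digraph that maps to the \<open>a\<close>-cycle has no such walk. Conversely, consider the digraph on all
  functions \<open>B\<^sup>a \<rightarrow> B\<close> in which every polymorphism points to the one obtained by rotating its
  arguments. It is a pp-power of \<open>B\<close>, and the projections form an \<open>a\<close>-cycle in it. A
  polymorphism whose orbit is shorter than \<open>a\<close> is invariant under rotation by \<open>a div p\<close> for some
  prime \<open>p\<close> dividing \<open>a\<close>, and identifying its arguments in blocks of \<open>a div p\<close> gives a
  cyclic polymorphism of arity \<open>p\<close>. If there is none, then all orbits are \<open>a\<close>-cycles and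
  the digraph maps to the \<open>a\<close>-cycle.\<close>

section \<open>Tuples as lists and their rotation\<close>

lemma map_upt_in_nlists: "(\<And>i. i < n \<Longrightarrow> f i \<in> A) \<Longrightarrow> map f [0..<n] \<in> nlists n A"
  by (rule nlistsI) auto

lemma nlistsE_mem: "xs \<in> nlists n A \<Longrightarrow> x \<in> set xs \<Longrightarrow> x \<in> A"
  unfolding nlists_def by auto

lemma map_in_nlists:
  "xs \<in> nlists n A \<Longrightarrow> (\<And>x. x \<in> A \<Longrightarrow> f x \<in> B) \<Longrightarrow> map f xs \<in> nlists n B"
  unfolding nlists_def by auto

lemma nlists_2_iff: "xs \<in> nlists 2 A \<longleftrightarrow> (\<exists>x\<in>A. \<exists>y\<in>A. xs = [x, y])"
  unfolding numeral_2_eq_2 by (auto simp: in_nlists_Suc_iff)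

lemma rotate1_in_nlists: "xs \<in> nlists n A \<Longrightarrow> rotate1 xs \<in> nlists n A"
  unfolding nlists_def by simp

lemma rotate1_conv_map_upt: "rotate1 xs = map (\<lambda>i. xs ! (Suc i mod length xs)) [0..<length xs]"
proof (rule nth_equalityI)
  fix i assume "i < length (rotate1 xs)"
  then have i: "i < length xs" by simp
  then show "rotate1 xs ! i = map (\<lambda>i. xs ! (Suc i mod length xs)) [0..<length xs] ! i"
    unfolding nth_rotate1[OF i] by simp
qed simp

text \<open>When each of the \<open>p\<close> entries is repeated in a block of length
  \<open>m\<close>, rotation by one whole block is rotation of the underlying tuple, since
  \<open>(m + i) mod (m * p) div m = (m + i) div m mod p\<close>.\<close>

lemma rotate_blocks:
  assumes "length ys = p" "p * m = a" "0 < m"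
  shows "rotate m (map (\<lambda>i. ys ! (i div m)) [0..<a]) = map (\<lambda>i. rotate1 ys ! (i div m)) [0..<a]"
proof (rule nth_equalityI)
  fix i assume "i < length (rotate m (map (\<lambda>i. ys ! (i div m)) [0..<a]))"
  then have i: "i < a" by simp
  then have "i div m < p"
    using less_mult_imp_div_less[of i p m] assms(2) by simp
  have "(m + i) mod (m * p) div m = (m + i) div m mod p"
    unfolding mod_mult2_eq using assms(3) by simp
  also have "(m + i) div m = Suc (i div m)"
    using assms(3) by (simp add: div_add_self1)
  also have "m * p = a"
    using assms(2) by (simp only: mult.commute)
  finally have block: "(m + i) mod a div m = Suc (i div m) mod p" .
  have "(m + i) mod a < a"
    using i by simp
  then have "rotate m (map (\<lambda>i. ys ! (i div m)) [0..<a]) ! i = ys ! ((m + i) mod a div m)"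
    using i by (simp add: nth_rotate)
  then show "rotate m (map (\<lambda>i. ys ! (i div m)) [0..<a]) ! i = map (\<lambda>i. rotate1 ys ! (i div m)) [0..<a] ! i"
    using i \<open>i div m < p\<close> assms(1) by (simp add: nth_rotate1 block)
qed simp

section \<open>Cyclic permutations of exact order\<close>

lemma funpow_mult_fixed: "(f ^^ k) x = x \<Longrightarrow> (f ^^ (k * j)) x = x"
  by (induction j) (simp_all add: funpow_add)

text \<open>By Bezout, a period \<open>k\<close> together with \<open>a\<close> yields the period
  \<open>d = gcd k a\<close>, a proper divisor of \<open>a\<close>. Some prime \<open>p\<close>
  divides the quotient of \<open>a\<close> by \<open>d\<close>, and then \<open>d\<close> divides
  \<open>a div p\<close>, so the maximal proper divisors are the only ones to exclude.\<close>

lemma no_shorter_period: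
  fixes f :: "'a \<Rightarrow> 'a"
  assumes per: "(f ^^ a) x = x" and prim: "\<And>p. prime p \<Longrightarrow> p dvd a \<Longrightarrow> (f ^^ (a div p)) x \<noteq> x"
    and k: "0 < k" "k < a"
  shows "(f ^^ k) x \<noteq> x"
proof
  assume fixed: "(f ^^ k) x = x"
  define d where "d = gcd k a"
  obtain u v where uv: "k * u = a * v + d"
    using bezout_nat[of k a] k by (auto simp: d_def)
  have "(f ^^ d) x = (f ^^ d) ((f ^^ (a * v)) x)"
    using funpow_mult_fixed[OF per] by simp
  also have "\<dots> = (f ^^ (k * u)) x"
    unfolding uv by (simp add: funpow_add add.commute)
  finally have d: "(f ^^ d) x = x"
    using funpow_mult_fixed[OF fixed] by simp
  have "d \<le> k" "d dvd a"
    using k by (auto simp: d_def intro: gcd_le1_nat)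
  then obtain e where e: "a = d * e" by blast
  with \<open>d \<le> k\<close> k have "e \<noteq> 1" by auto
  then obtain p where p: "prime p" "p dvd e"
    using prime_factor_nat by blast
  then obtain e' where "e = p * e'" by blast
  with e have "a div p = d * e'" "p dvd a"
    using prime_gt_0_nat[OF \<open>prime p\<close>] by auto
  then show False
    using prim[OF \<open>prime p\<close>] funpow_mult_fixed[OF d] by simp
qed

text \<open>Choose an element of each orbit and count the steps from it.\<close>

lemma cyclic_labelling:
  fixes f :: "'a \<Rightarrow> 'a"
  assumes a: "0 < a"
    and per: "\<And>x. x \<in> S \<Longrightarrow> (f ^^ a) x = x"
    and exact: "\<And>x k. x \<in> S \<Longrightarrow> 0 < k \<Longrightarrow> k < a \<Longrightarrow> (f ^^ k) x \<noteq> x"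
    and closed: "\<And>x. x \<in> S \<Longrightarrow> f x \<in> S"
  shows "\<exists>g. \<forall>x\<in>S. g x < a \<and> g (f x) = Suc (g x) mod a"
proof -
  define orb where "orb x = range (\<lambda>k. (f ^^ k) x)" for x
  \<comment> \<open>\<open>r x\<close> depends on \<open>x\<close> only through the set
    \<open>orb x\<close>, so all points of an orbit get the same representative.\<close>
  define r where "r x = (SOME y. y \<in> orb x)" for x
  define g where "g x = (THE k. k < a \<and> (f ^^ k) (r x) = x)" for x
  have pow_closed: "(f ^^ k) x \<in> S" if "x \<in> S" for x k
    using that closed by (induction k) auto
  have r_orb: "r x \<in> orb x" for x
    unfolding r_def by (rule someI[of _ x]) (auto simp: orb_def intro: range_eqI[of _ _ 0])
  have r_S: "r x \<in> S" if "x \<in> S" for x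
    using r_orb[of x] pow_closed[OF that] by (auto simp: orb_def)
  have inj: "i = j" if "x \<in> S" "i < a" "j < a" "(f ^^ i) x = (f ^^ j) x" for x i j
  proof -
    have "\<not> i < j" if "i < a" "j < a" "(f ^^ i) x = (f ^^ j) x" for i j
    proof
      assume "i < j"
      then have "(f ^^ (j - i)) ((f ^^ i) x) = (f ^^ j) x"
        by (metis funpow_add comp_apply le_add_diff_inverse2 less_imp_le)
      moreover have "0 < j - i" "j - i < a"
        using that \<open>i < j\<close> by linarith+
      ultimately show False
        using exact[OF pow_closed[OF \<open>x \<in> S\<close>, of i], of "j - i"] that by simp
    qed
    then show ?thesis
      using that by (metis linorder_neqE_nat)
  qed
  have g_eq: "g x = k" if "x \<in> S" "k < a" "(f ^^ k) (r x) = x" for x k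
    unfolding g_def
  proof (rule the_equality)
    show "k < a \<and> (f ^^ k) (r x) = x" using that by simp
  next
    fix l assume "l < a \<and> (f ^^ l) (r x) = x"
    then show "l = k" using inj[OF r_S] that by metis
  qed
  have g: "g x < a \<and> (f ^^ g x) (r x) = x" if x: "x \<in> S" for x
  proof -
    obtain j where j: "r x = (f ^^ j) x"
      using r_orb[of x] by (auto simp: orb_def)
    \<comment> \<open>The outer \<open>mod a\<close> matters when \<open>a\<close> divides
      \<open>j\<close>: then \<open>a - j mod a\<close> is \<open>a\<close>, which is not an
      admissible label.\<close>
    define k where "k = (a - j mod a) mod a"
    have "(f ^^ k) (r x) = (f ^^ (a - j mod a)) (r x)"
      unfolding k_def by (rule funpow_mod_eq[OF per[OF r_S[OF x]]])
    also have "\<dots> = (f ^^ (a - j mod a)) ((f ^^ (j mod a)) x)"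
      unfolding j funpow_mod_eq[OF per[OF x]] ..
    also have "\<dots> = (f ^^ (a - j mod a + j mod a)) x"
      by (simp only: funpow_add comp_apply)
    also have "\<dots> = x"
      using a per[OF x] by simp
    finally have "(f ^^ k) (r x) = x" .
    moreover have "k < a"
      using a by (simp add: k_def)
    ultimately show ?thesis
      using g_eq[OF x] by auto
  qed
  have r_step: "r (f x) = r x" if x: "x \<in> S" for x
  proof -
    have "orb (f x) = orb x"
    proof
      show "orb (f x) \<subseteq> orb x"
        unfolding orb_def by (auto simp: funpow_swap1[symmetric] intro: range_eqI[of _ _ "Suc _"])
      \<comment> \<open>From \<open>f x\<close>, another \<open>a - 1\<close> steps lead back to
        \<open>x\<close>.\<close>
      show "orb x \<subseteq> orb (f x)"
      proof
        fix y assume "y \<in> orb x"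
        then obtain k where "y = (f ^^ k) x" by (auto simp: orb_def)
        also have "\<dots> = (f ^^ k) ((f ^^ (a - 1)) (f x))"
          using per[OF x] a by (metis funpow_Suc_right comp_apply Suc_diff_1)
        also have "\<dots> = (f ^^ (k + (a - 1))) (f x)"
          by (simp add: funpow_add)
        finally show "y \<in> orb (f x)" by (auto simp: orb_def)
      qed
    qed
    then show ?thesis by (simp add: r_def)
  qed
  have "g (f x) = Suc (g x) mod a" if x: "x \<in> S" for x
  proof (rule g_eq)
    have "(f ^^ (Suc (g x) mod a)) (r x) = (f ^^ Suc (g x)) (r x)"
      using per[OF r_S[OF x]] by (rule funpow_mod_eq)
    then show "(f ^^ (Suc (g x) mod a)) (r (f x)) = f x"
      using g[OF x] by (simp add: r_step[OF x])
  qed (use a x closed in auto)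
  with g show ?thesis by auto
qed

section \<open>Elementary facts on structures, homomorphisms and powers\<close>

lemma is_structD: "is_struct A \<Longrightarrow> R \<in> Sym A \<Longrightarrow> t \<in> Rel A R \<Longrightarrow> t \<in> nlists (Ar A R) (Dom A)"
  by (auto simp: is_struct_def)

lemma is_hom_Rel: "is_hom A B h \<Longrightarrow> R \<in> Sym A \<Longrightarrow> t \<in> Rel A R \<Longrightarrow> map h t \<in> Rel B R"
  by (simp add: is_hom_def)

lemma is_hom_Dom: "is_hom A B h \<Longrightarrow> x \<in> Dom A \<Longrightarrow> h x \<in> Dom B"
  by (auto simp: is_hom_def)

lemma struct_power_simps [simp]:
  "Dom (struct_power B n) = nlists n (Dom B)"
  "Sym (struct_power B n) = Sym B"
  "Ar (struct_power B n) = Ar B"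
  "T \<in> Rel (struct_power B n) R \<longleftrightarrow>
     T \<in> nlists (Ar B R) (nlists n (Dom B)) \<and> (\<forall>j<n. map (\<lambda>x. x ! j) T \<in> Rel B R)"
  by (simp_all add: struct_power_def)

section \<open>Primitive positive definability\<close>

lemma sat_cong_free_vars:
  "(\<And>v. v \<in> free_vars \<phi> \<Longrightarrow> s v = s' v) \<Longrightarrow> sat A s \<phi> \<longleftrightarrow> sat A s' \<phi>"
proof (induction \<phi> arbitrary: s s')
  case (Atom R xs)
  then have "map s xs = map s' xs" by simp
  then show ?case by (simp only: sat.simps)
next
  case (Conj \<phi> \<psi>)
  show ?case
    using Conj.IH[of s s'] Conj.prems by simp
next
  case (Exi x \<phi>)
  have "sat A (s(x := b)) \<phi> \<longleftrightarrow> sat A (s'(x := b)) \<phi>" for b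
    by (rule Exi.IH) (use Exi.prems in auto)
  then show ?case by simp
qed auto

text \<open>Atoms are preserved because \<open>f\<close> is a homomorphism; an existential witness
  for the combined assignment is \<open>f\<close> applied to the \<open>n\<close> given witnesses.
  With \<open>0 < n\<close> the case \<open>Bot\<close> is vacuous. Only free variables must take
  values in the domain, because \<open>(!) t\<close> is unspecified beyond the length of
  \<open>t\<close>.\<close>

lemma sat_polymorphism:
  assumes f: "is_hom (struct_power A n) A f"
  shows "formula_over A \<phi> \<Longrightarrow> (\<And>j. j < n \<Longrightarrow> sat A (s j) \<phi>) \<Longrightarrow> 0 < n \<Longrightarrow>
    (\<And>j v. j < n \<Longrightarrow> v \<in> free_vars \<phi> \<Longrightarrow> s j v \<in> Dom A) \<Longrightarrow>
    sat A (\<lambda>v. f (map (\<lambda>j. s j v) [0..<n])) \<phi>"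
proof (induction \<phi> arbitrary: s)
  case (Atom R xs)
  let ?T = "map (\<lambda>v. map (\<lambda>j. s j v) [0..<n]) xs"
  have "?T \<in> nlists (Ar A R) (nlists n (Dom A))"
    using Atom.prems by (auto intro!: nlistsI)
  moreover have "map (\<lambda>x. x ! j) ?T \<in> Rel A R" if "j < n" for j
    using Atom.prems(2)[OF that] that by (simp add: comp_def)
  ultimately have "?T \<in> Rel (struct_power A n) R"
    by simp
  then have "map f ?T \<in> Rel A R"
    using Atom.prems(1) by (intro is_hom_Rel[OF f]) simp_all
  then show ?case by (simp add: comp_def)
next
  case (Equal x y)
  then have "map (\<lambda>j. s j x) [0..<n] = map (\<lambda>j. s j y) [0..<n]" by simp
  then show ?case by (simp only: sat.simps)
next
  case (Conj \<phi> \<psi>)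
  show ?case
    using Conj.IH[of s] Conj.prems by simp
next
  case (Exi x \<phi>)
  have "\<forall>j\<in>{..<n}. \<exists>b\<in>Dom A. sat A ((s j)(x := b)) \<phi>"
    using Exi.prems(2) by auto
  then obtain b where b: "\<And>j. j < n \<Longrightarrow> b j \<in> Dom A" "\<And>j. j < n \<Longrightarrow> sat A ((s j)(x := b j)) \<phi>"
    by (metis lessThan_iff)
  have "sat A (\<lambda>v. f (map (\<lambda>j. ((s j)(x := b j)) v) [0..<n])) \<phi>"
    by (rule Exi.IH[of "\<lambda>j. (s j)(x := b j)"]) (use Exi.prems b in \<open>auto simp: fun_upd_def\<close>)
  moreover have "(\<lambda>v. f (map (\<lambda>j. ((s j)(x := b j)) v) [0..<n])) =
      (\<lambda>v. f (map (\<lambda>j. s j v) [0..<n]))(x := f (map b [0..<n]))"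
    by auto
  moreover have "f (map b [0..<n]) \<in> Dom A"
    using b by (intro is_hom_Dom[OF f]) (simp add: map_upt_in_nlists)
  ultimately show ?case by auto
qed simp

text \<open>Preservation in terms of tuples: \<open>f\<close> acts on the columns of the array with
  rows \<open>w j\<close>. The assignment read off the resulting list agrees with the combined one
  below \<open>k\<close>, where all free variables lie.\<close>

lemma pp_definable_polymorphism:
  assumes f: "is_hom (struct_power A n) A f" and n: "0 < n" and S: "pp_definable A k S"
    and w: "\<And>j. j < n \<Longrightarrow> w j \<in> S"
  shows "map (\<lambda>v. f (map (\<lambda>j. w j ! v) [0..<n])) [0..<k] \<in> S"
proof -
  obtain \<phi> where \<phi>: "formula_over A \<phi>" "free_vars \<phi> \<subseteq> {..<k}"
    and S_eq: "S = {t \<in> nlists k (Dom A). sat A ((!) t) \<phi>}"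
    using S by (auto simp: pp_definable_def)
  have w_in: "w j ! v \<in> Dom A" if "j < n" "v < k" for j v
    using w[of j] that by (auto simp: S_eq intro: nlistsE_nth_in)
  let ?u = "map (\<lambda>v. f (map (\<lambda>j. w j ! v) [0..<n])) [0..<k]"
  have "sat A (\<lambda>v. f (map (\<lambda>j. w j ! v) [0..<n])) \<phi>"
    by (rule sat_polymorphism[OF f \<phi>(1)]) (use w w_in \<phi>(2) n in \<open>auto simp: S_eq\<close>)
  moreover have "sat A ((!) ?u) \<phi> = sat A (\<lambda>v. f (map (\<lambda>j. w j ! v) [0..<n])) \<phi>"
    by (rule sat_cong_free_vars) (use \<phi>(2) in auto)
  moreover have "?u \<in> nlists k (Dom A)"
  proof (rule map_upt_in_nlists)
    fix v assume "v < k"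
    then show "f (map (\<lambda>j. w j ! v) [0..<n]) \<in> Dom A"
      using w_in by (intro is_hom_Dom[OF f]) (simp add: map_upt_in_nlists)
  qed
  ultimately show ?thesis by (simp add: S_eq)
qed

lemma pp_definable_conj:
  assumes "pp_definable A k {t \<in> nlists k (Dom A). P t}"
    and "pp_definable A k {t \<in> nlists k (Dom A). Q t}"
  shows "pp_definable A k {t \<in> nlists k (Dom A). P t \<and> Q t}"
proof -
  obtain \<phi> \<psi> where "formula_over A \<phi>" "free_vars \<phi> \<subseteq> {..<k}"
    "{t \<in> nlists k (Dom A). P t} = {t \<in> nlists k (Dom A). sat A ((!) t) \<phi>}"
    "formula_over A \<psi>" "free_vars \<psi> \<subseteq> {..<k}"
    "{t \<in> nlists k (Dom A). Q t} = {t \<in> nlists k (Dom A). sat A ((!) t) \<psi>}"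
    using assms unfolding pp_definable_def by auto
  then show ?thesis
    unfolding pp_definable_def by (intro exI[of _ "Conj \<phi> \<psi>"]) auto
qed

lemma pp_definable_atom:
  assumes "R \<in> Sym A" "length xs = Ar A R" "set xs \<subseteq> {..<k}"
  shows "pp_definable A k {t \<in> nlists k (Dom A). map ((!) t) xs \<in> Rel A R}"
  unfolding pp_definable_def by (rule exI[of _ "Atom R xs"]) (use assms in simp)

lemma pp_definable_equal:
  assumes "x < k" "y < k"
  shows "pp_definable A k {t \<in> nlists k (Dom A). t ! x = t ! y}"
  unfolding pp_definable_def by (rule exI[of _ "Equal x y"]) (use assms in simp)

text \<open>The syntax has no constant for truth, so the empty conjunction is written as an equation
  of variable \<open>0\<close> with itself; \<open>0 < k\<close> makes that variable
  available.\<close>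

lemma pp_definable_Ball:
  assumes "finite I" "0 < k"
    and "\<And>i. i \<in> I \<Longrightarrow> pp_definable A k {t \<in> nlists k (Dom A). P i t}"
  shows "pp_definable A k {t \<in> nlists k (Dom A). \<forall>i\<in>I. P i t}"
  using assms(1,3)
proof (induction I rule: finite_induct)
  case empty
  then show ?case
    using pp_definable_equal[OF assms(2) assms(2)] by simp
next
  case (insert i I)
  then show ?case
    using pp_definable_conj[of A k "P i" "\<lambda>t. \<forall>i\<in>I. P i t"] by simp
qed

section \<open>Homomorphisms and powers\<close>

lemma is_hom_comp: "is_hom A B g \<Longrightarrow> is_hom B C h \<Longrightarrow> is_hom A C (h \<circ> g)"
  by (fastforce simp: is_hom_def same_signature_def simp flip: map_map)

lemma hom_equivalent_trans: "hom_equivalent A B \<Longrightarrow> hom_equivalent B C \<Longrightarrow> hom_equivalent A C"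
  unfolding hom_equivalent_def by (elim conjE exE) (intro conjI exI; erule (1) is_hom_comp)

text \<open>The inverse bijection preserves relations because the tuples in the relations of
  \<open>Q\<close> have all entries in \<open>Dom Q\<close>, where the isomorphism can be undone
  entrywise.\<close>

lemma isomorphic_imp_hom_equivalent:
  assumes iso: "isomorphic P Q" and P: "is_struct P" and Q: "is_struct Q"
  shows "hom_equivalent P Q"
proof -
  obtain h where sig: "same_signature P Q" and bij: "bij_betw h (Dom P) (Dom Q)"
    and rel: "\<And>R t. R \<in> Sym P \<Longrightarrow> t \<in> nlists (Ar P R) (Dom P) \<Longrightarrow> t \<in> Rel P R \<longleftrightarrow> map h t \<in> Rel Q R"
    using iso by (auto simp: isomorphic_def)
  have "map h t \<in> Rel Q R" if "R \<in> Sym P" "t \<in> Rel P R" for R t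
    using rel[OF that(1) is_structD[OF P that]] that(2) by simp
  with sig bij have "is_hom P Q h"
    unfolding is_hom_def bij_betw_def by blast
  moreover
  let ?k = "inv_into (Dom P) h"
  have k: "?k ` Dom Q \<subseteq> Dom P"
    using bij bij_betw_inv_into bij_betw_imp_surj_on by blast
  have "map ?k t \<in> Rel P R" if R: "R \<in> Sym Q" and t: "t \<in> Rel Q R" for R t
  proof -
    have t': "t \<in> nlists (Ar P R) (Dom Q)" "R \<in> Sym P"
      using is_structD[OF Q R t] R sig by (auto simp: same_signature_def)
    then have "map ?k t \<in> nlists (Ar P R) (Dom P)"
      using k by (auto intro: map_in_nlists)
    moreover have "map h (map ?k t) = t"
      unfolding map_map
      by (rule map_idI) (use t' bij in \<open>auto simp: bij_betw_def f_inv_into_f dest: nlistsE_mem\<close>)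
    ultimately show ?thesis
      using rel[OF t'(2)] t by simp
  qed
  with sig k have "is_hom Q P ?k"
    by (auto simp: is_hom_def same_signature_def)
  ultimately show ?thesis by (auto simp: hom_equivalent_def)
qed

lemma is_hom_projection:
  assumes "i < n"
  shows "is_hom (struct_power B n) B (\<lambda>x. x ! i)"
  using assms by (auto simp: is_hom_def same_signature_def intro: nlistsE_nth_in)

text \<open>Coordinate \<open>j\<close> of the new tuple is coordinate \<open>\<sigma> j\<close> of
  the old one, so relations that hold coordinatewise are inherited. This serves both for rotating
  arguments and for repeating them in blocks.\<close>

lemma is_hom_reindex:
  assumes \<sigma>: "\<And>i. i < m \<Longrightarrow> \<sigma> i < k"
  shows "is_hom (struct_power B k) (struct_power B m) (\<lambda>x. map (\<lambda>i. x ! \<sigma> i) [0..<m])"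
    (is "is_hom _ _ ?h")
proof -
  have h: "?h x \<in> nlists m (Dom B)" if "x \<in> nlists k (Dom B)" for x
    using that \<sigma> by (auto intro!: map_upt_in_nlists nlistsE_nth_in)
  have "map ?h T \<in> Rel (struct_power B m) R" if T: "T \<in> Rel (struct_power B k) R" for R T
  proof -
    have "map ?h T \<in> nlists (Ar B R) (nlists m (Dom B))"
      using T h by (auto intro: map_in_nlists)
    moreover have "map (\<lambda>x. x ! j) (map ?h T) = map (\<lambda>x. x ! \<sigma> j) T" if "j < m" for j
      using that by simp
    ultimately show ?thesis
      using T \<sigma> by (simp del: map_map)
  qed
  with h show ?thesis
    unfolding is_hom_def same_signature_def by auto
qed

text \<open>Tuples in the relations of a structure have all entries in its domain, so values
  elsewhere never enter.\<close>

lemma is_hom_cong: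
  assumes "is_hom A B g" "is_struct A" "\<And>x. x \<in> Dom A \<Longrightarrow> g x = h x"
  shows "is_hom A B h"
proof -
  have "map h t \<in> Rel B R" if "R \<in> Sym A" "t \<in> Rel A R" for R t
  proof -
    have "map h t = map g t"
      using nlistsE_mem[OF is_structD[OF assms(2) that]] assms(3) by simp
    then show ?thesis
      using is_hom_Rel[OF assms(1) that] by (simp only:)
  qed
  with assms show ?thesis
    unfolding is_hom_def by auto
qed

lemma is_struct_power: "is_struct B \<Longrightarrow> is_struct (struct_power B n)"
  using nlists_not_empty[of "Dom B" n] by (auto simp: is_struct_def)

lemma is_hom_rotate1:
  assumes "is_struct B"
  shows "is_hom (struct_power B a) (struct_power B a) rotate1"
proof (rule is_hom_cong)
  show "is_hom (struct_power B a) (struct_power B a) (\<lambda>x. map (\<lambda>i. x ! (Suc i mod a)) [0..<a])"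
    by (rule is_hom_reindex) simp
  show "map (\<lambda>i. x ! (Suc i mod a)) [0..<a] = rotate1 x" if "x \<in> Dom (struct_power B a)" for x
    using that by (simp add: rotate1_conv_map_upt)
qed (rule is_struct_power[OF assms])

section \<open>Cyclic polymorphisms rule out directed cycles\<close>

text \<open>For \<open>m = a div p\<close>, a cyclic polymorphism applied to the closed walk
  \<open>c\<^sub>0, c\<^sub>1, \<dots>\<close> at positions \<open>i, i + m, i + 2m, \<dots>\<close> yields a walk that closes
  after only \<open>m\<close> steps.\<close>

lemma cyclic_loop_imp_not_pp_constructs:
  fixes B :: "('r, 'b) rel_struct"
  assumes a: "0 < a" and p: "1 < p" "p dvd a" and loop: "Pol_satisfies_cyclic_loop B p"
  shows "\<not> pp_constructs B (dicycle a)"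
proof
  assume "pp_constructs B (dicycle a)"
  then obtain P :: "(unit, 'b list) rel_struct"
    where P: "is_struct P" "hom_equivalent (dicycle a) P" and "is_pp_power B P"
    unfolding pp_constructs_def by auto
  from \<open>is_pp_power B P\<close> obtain n and Q :: "(unit, 'b list) rel_struct"
    where Q: "is_struct Q" "Dom Q = nlists n (Dom B)" "isomorphic P Q"
      and pp: "\<forall>S\<in>Sym Q. pp_definable B (Ar Q S * n) (concat ` Rel Q S)"
    unfolding is_pp_power_def by auto
  have "hom_equivalent P Q"
    by (rule isomorphic_imp_hom_equivalent[OF Q(3) P(1) Q(1)])
  with P(2) have "hom_equivalent (dicycle a) Q"
    by (rule hom_equivalent_trans)
  then obtain c g where c: "is_hom (dicycle a) Q c" and g: "is_hom Q (dicycle a) g"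
    unfolding hom_equivalent_def by (elim conjE exE)
  have sig: "Sym Q = {()}" "Ar Q () = 2"
    using c by (auto simp: is_hom_def same_signature_def dicycle_def)
  define E where "E = Rel Q ()"
  have E: "E \<subseteq> nlists 2 (nlists n (Dom B))"
    using Q(1,2) sig by (simp add: is_struct_def E_def)
  have c_edge: "[c (i mod a), c (Suc i mod a)] \<in> E" for i
  proof -
    have "[i mod a, (i mod a + 1) mod a] \<in> Rel (dicycle a) ()"
      using a by (auto simp: dicycle_def)
    then have "map c [i mod a, (i mod a + 1) mod a] \<in> E"
      using c sig by (auto simp: is_hom_def dicycle_def E_def)
    then show ?thesis
      by (simp add: mod_Suc_eq)
  qed
  have g_edge: "g x < a \<and> g y = Suc (g x) mod a" if "[x, y] \<in> E" for x y
  proof -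
    have "map g [x, y] \<in> Rel (dicycle a) ()"
      using g sig that unfolding is_hom_def E_def by auto
    then show ?thesis by (auto simp: dicycle_def)
  qed
  obtain f where f: "is_hom (struct_power B p) B f"
    and cyc: "\<And>x. x \<in> nlists p (Dom B) \<Longrightarrow> f x = f (rotate1 x)"
    using loop unfolding Pol_satisfies_cyclic_loop_def Pol_def by blast
  define m where "m = a div p"
  have m: "p * m = a" "0 < m" "m < a"
    using a p by (auto simp: m_def)
  \<comment> \<open>\<open>y i v\<close> collects the \<open>v\<close>-th coordinates of the
    \<open>p\<close> equidistant vertices starting at position \<open>i\<close>; \<open>u i\<close>
    is the result of applying \<open>f\<close> to these vertices coordinatewise.\<close>
  define y where "y i v = map (\<lambda>j. c ((i + j * m) mod a) ! v) [0..<p]" for i v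
  define u where "u i = map (\<lambda>v. f (y i v)) [0..<n]" for i
  have c_in: "c (i mod a) \<in> nlists n (Dom B)" for i
    using c_edge[of i] E by (auto simp: nlists_2_iff)
  have u_edge: "[u i, u (Suc i)] \<in> E" for i
  proof -
    \<comment> \<open>The edge leaving position \<open>i + j * m\<close>, flattened to length
      \<open>2 * n\<close>, because pp-definability speaks of the flattened relation.\<close>
    define w where "w j = c ((i + j * m) mod a) @ c (Suc (i + j * m) mod a)" for j
    have w: "w j \<in> concat ` E" for j
      unfolding w_def by (rule image_eqI[OF _ c_edge]) simp
    have w_image: "map (\<lambda>v. f (map (\<lambda>j. w j ! v) [0..<p])) [0..<2 * n] \<in> concat ` E"
      by (rule pp_definable_polymorphism[OF f]) (use p pp sig w in \<open>auto simp: E_def\<close>)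
    have "map (\<lambda>v. f (map (\<lambda>j. w j ! v) [0..<p])) [0..<2 * n] = u i @ u (Suc i)"
      using nlistsE_length[OF c_in]
      by (intro nth_equalityI) (auto simp: w_def u_def y_def nth_append)
    with w_image obtain e where "e \<in> E" "u i @ u (Suc i) = concat e" by auto
    moreover from this(1) E have "e \<in> nlists 2 (nlists n (Dom B))"
      by blast
    \<comment> \<open>Both endpoints have length \<open>n\<close>, so the edge can be recovered from
      the flattened tuple.\<close>
    then obtain s t where "e = [s, t]" "length s = n" "length t = n"
      by (auto simp: nlists_2_iff)
    ultimately show ?thesis by (simp add: u_def)
  qed
  \<comment> \<open>Moving the start by \<open>m\<close> replaces each sampled vertex by the next
    one; the last wraps around to the first because \<open>p * m = a\<close>.\<close>
  have "y m v = rotate1 (y 0 v)" for v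
  proof -
    have "(m + j * m) mod a = (Suc j mod p) * m mod a" for j
    proof -
      have "(m + j * m) mod a = (Suc j * m) mod (p * m)"
        by (simp add: m(1))
      then show ?thesis
        unfolding mod_mult_mult2 by (simp flip: m(1) add: mod_mult_mult2)
    qed
    then show ?thesis
      by (intro nth_equalityI) (simp_all add: y_def nth_rotate1)
  qed
  moreover have "y 0 v \<in> nlists p (Dom B)" if "v < n" for v
    unfolding y_def by (rule map_upt_in_nlists) (simp add: nlistsE_nth_in[OF c_in that])
  ultimately have "f (y m v) = f (y 0 v)" if "v < n" for v
    using cyc[of "y 0 v"] that by metis
  then have u_m: "u m = u 0"
    by (simp add: u_def)
  \<comment> \<open>\<open>g\<close> advances by one modulo \<open>a\<close> along every edge, so it
    counts the steps of the walk \<open>u\<close>. Closing after \<open>m\<close> steps with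
    \<open>0 < m < a\<close> is then impossible.\<close>
  have "g (u i) = (g (u 0) + i) mod a" for i
  proof (induction i)
    case 0
    then show ?case using g_edge[OF u_edge[of 0]] by simp
  next
    case (Suc i)
    then show ?case using g_edge[OF u_edge[of i]] by (simp add: mod_Suc_eq)
  qed
  from this[of m] have "g (u 0) = (g (u 0) + m) mod a"
    by (simp add: u_m)
  moreover have "g (u 0) < a"
    using g_edge[OF u_edge[of 0]] by simp
  ultimately show False
    using m by (cases "g (u 0) + m < a") (auto simp: le_mod_geq not_less)
qed

section \<open>The digraph of polymorphisms\<close>

text \<open>A list \<open>t\<close> indexed by the enumeration \<open>es\<close> of \<open>B\<^sup>a\<close> is the table of the function
  \<open>x \<mapsto> t ! pos x\<close> from \<open>B\<^sup>a\<close> to \<open>B\<close>.\<close>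

locale tuple_enumeration =
  fixes B :: "('r, 'b) rel_struct" and a :: nat and es :: "'b list list"
  assumes struct: "is_struct B" and finite_Sym: "finite (Sym B)" and a_pos: "0 < a"
    and distinct_es: "distinct es" and set_es: "set es = nlists a (Dom B)"
begin

abbreviation "n \<equiv> length es"

definition pos :: "'b list \<Rightarrow> nat" where
  "pos = inv_into {..<n} ((!) es)"

definition rot :: "'b list \<Rightarrow> 'b list" where
  "rot t = map (\<lambda>x. t ! pos (rotate1 x)) es"

definition pols :: "'b list set" where
  "pols = {t \<in> nlists n (Dom B). is_hom (struct_power B a) B (\<lambda>x. t ! pos x)}"

text \<open>Tables that are not polymorphisms remain as isolated vertices, because the domain of a
  pp-power is a full power of \<open>Dom B\<close>.\<close>

definition pol_digraph :: "(unit, 'b list) rel_struct" where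
  "pol_digraph = \<lparr>Dom = nlists n (Dom B), Sym = {()}, Ar = (\<lambda>_. 2),
     Rel = (\<lambda>_. {[t, rot t] | t. t \<in> pols})\<rparr>"

section \<open>Tables of functions and the action of rotation on them\<close>

lemma pos: "x \<in> nlists a (Dom B) \<Longrightarrow> pos x < n \<and> es ! pos x = x"
  unfolding pos_def set_es[symmetric] set_conv_nth
  using inv_into_into[of x "(!) es" "{..<n}"] f_inv_into_f[of x "(!) es" "{..<n}"] by auto

lemma pos_less: "x \<in> nlists a (Dom B) \<Longrightarrow> pos x < n"
  by (simp add: pos)

lemma pos_nth: "i < n \<Longrightarrow> pos (es ! i) = i"
  unfolding pos_def using distinct_es
  by (intro inv_into_f_f) (auto simp: inj_on_def nth_eq_iff_index_eq)

lemma n_pos: "0 < n"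
proof -
  have "es \<noteq> []"
    using nlists_not_empty[of "Dom B" a] struct set_es by (auto simp: is_struct_def)
  then show ?thesis by simp
qed

lemma table_map: "x \<in> nlists a (Dom B) \<Longrightarrow> map h es ! pos x = h x"
  using pos[of x] by simp

lemma map_es_in:
  assumes "\<And>x. x \<in> nlists a (Dom B) \<Longrightarrow> h x \<in> Dom B"
  shows "map h es \<in> nlists n (Dom B)"
  using assms by (auto simp: set_es)

lemma table_in: "t \<in> nlists n (Dom B) \<Longrightarrow> x \<in> nlists a (Dom B) \<Longrightarrow> t ! pos x \<in> Dom B"
  using pos[of x] by (auto intro: nlistsE_nth_in)

lemma map_table:
  assumes "t \<in> nlists n (Dom B)"
  shows "map (\<lambda>x. t ! pos x) es = t"
  using assms by (intro nth_equalityI) (simp_all add: pos_nth)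

text \<open>Tabulating \<open>h\<close> and reading the table back agrees with \<open>h\<close> on
  all \<open>a\<close>-tuples over the domain.\<close>

lemma map_in_pols:
  assumes "is_hom (struct_power B a) B h"
  shows "map h es \<in> pols"
proof -
  have "is_hom (struct_power B a) B (\<lambda>x. map h es ! pos x)"
    by (rule is_hom_cong[OF assms is_struct_power[OF struct]])
      (simp add: table_map struct_power_def)
  then show ?thesis
    using assms map_es_in[of h] by (auto simp: pols_def is_hom_def struct_power_def)
qed

lemma rot_in_pols: "t \<in> pols \<Longrightarrow> rot t \<in> pols"
  using map_in_pols[OF is_hom_comp[OF is_hom_rotate1[OF struct], where C = B and h = "\<lambda>x. t ! pos x"]]
  by (simp add: pols_def rot_def comp_def)

lemma rot_power:
  assumes "t \<in> nlists n (Dom B)"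
  shows "(rot ^^ k) t = map (\<lambda>x. t ! pos (rotate k x)) es"
proof (induction k)
  case 0
  then show ?case using map_table[OF assms] by simp
next
  case (Suc k)
  have "t ! pos (rotate k (rotate1 x)) = t ! pos (rotate (Suc k) x)" for x
    by (simp add: rotate1_rotate_swap)
  then show ?case
    using Suc by (auto simp: rot_def set_es table_map rotate1_in_nlists)
qed

lemma rot_power_a:
  assumes "t \<in> nlists n (Dom B)"
  shows "(rot ^^ a) t = t"
proof -
  have "map (\<lambda>x. t ! pos (rotate a x)) es = map (\<lambda>x. t ! pos x) es"
    by (auto simp: set_es)
  then show ?thesis
    unfolding rot_power[OF assms] using map_table[OF assms] by simp
qed

section \<open>The digraph of polymorphisms as a pp-power\<close>

lemma is_struct_pol_digraph: "is_struct pol_digraph"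
  using struct nlists_not_empty[of "Dom B" n] rot_in_pols
  by (auto simp: is_struct_def pol_digraph_def nlists_2_iff pols_def)

lemma finite_power_Rel: "R \<in> Sym B \<Longrightarrow> finite (Rel (struct_power B a) R)"
proof (rule finite_subset)
  show "Rel (struct_power B a) R \<subseteq> nlists (Ar B R) (set es)"
    by (auto simp: set_es)
  show "finite (nlists (Ar B R) (set es))"
    by (simp only: nlists_set List.finite_set)
qed

text \<open>Preservation of a tuple \<open>T\<close> of the power is one atomic condition on the
  entries of \<open>t\<close> at the positions \<open>map pos T\<close>. Being a polymorphism thus
  becomes a conjunction of atoms in the table entries.\<close>

lemma pols_iff:
  assumes "t \<in> nlists n (Dom B)"
  shows "t \<in> pols \<longleftrightarrow> (\<forall>R\<in>Sym B. \<forall>T\<in>Rel (struct_power B a) R. map ((!) t) (map pos T) \<in> Rel B R)"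
  using assms table_in[OF assms]
  by (auto simp: pols_def is_hom_def same_signature_def struct_power_def comp_def)

text \<open>A tuple of length \<open>2 * n\<close> is a pair of tables. The atoms force the first
  half to be a polymorphism, and the equations force the second half to be its rotation.\<close>

lemma concat_Rel_pol_digraph:
  "concat ` Rel pol_digraph () = {w \<in> nlists (2 * n) (Dom B).
     (\<forall>R\<in>Sym B. \<forall>T\<in>Rel (struct_power B a) R. map ((!) w) (map pos T) \<in> Rel B R) \<and>
     (\<forall>x\<in>nlists a (Dom B). w ! (n + pos x) = w ! pos (rotate1 x))}"
    (is "_ = {w \<in> _. ?H w \<and> ?J w}")
proof -
  have H: "?H (t @ u) \<longleftrightarrow> t \<in> pols" if t: "t \<in> nlists n (Dom B)" for t u
  proof -
    have "map ((!) (t @ u)) (map pos T) = map ((!) t) (map pos T)"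
      if T: "R \<in> Sym B" "T \<in> Rel (struct_power B a) R" for R T
      using t T pos by (auto simp: struct_power_def nth_append dest: nlistsE_mem)
    then show ?thesis
      unfolding pols_iff[OF t] by (intro ball_cong refl) (simp only:)
  qed
  have J: "?J (t @ u) \<longleftrightarrow> u = rot t" if t: "t \<in> nlists n (Dom B)" and u: "u \<in> nlists n (Dom B)" for t u
  proof -
    have "?J (t @ u) \<longleftrightarrow> (\<forall>x\<in>nlists a (Dom B). u ! pos x = t ! pos (rotate1 x))"
      using t pos rotate1_in_nlists by (auto simp: nth_append)
    also have "\<dots> \<longleftrightarrow> map (\<lambda>x. u ! pos x) es = rot t"
      by (simp add: rot_def set_es)
    also have "map (\<lambda>x. u ! pos x) es = u"
      by (rule map_table[OF u])
    finally show ?thesis .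
  qed
  have rot_in: "rot t \<in> nlists n (Dom B)" if "t \<in> pols" for t
    using rot_in_pols[OF that] by (simp add: pols_def)
  have split: "\<exists>t u. w = t @ u \<and> t \<in> nlists n (Dom B) \<and> u \<in> nlists n (Dom B)"
    if w: "w \<in> nlists (2 * n) (Dom B)" for w
    by (rule exI[of _ "take n w"], rule exI[of _ "drop n w"])
      (use w in \<open>auto intro!: nlistsI dest!: in_set_takeD in_set_dropD dest: nlistsE_mem\<close>)
  show ?thesis
  proof (intro equalityI subsetI)
    fix w assume "w \<in> concat ` Rel pol_digraph ()"
    then obtain t where t: "t \<in> pols" "w = t @ rot t"
      by (auto simp: pol_digraph_def)
    then have "t \<in> nlists n (Dom B)" by (simp add: pols_def)
    then show "w \<in> {w \<in> nlists (2 * n) (Dom B). ?H w \<and> ?J w}"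
      using H J t rot_in nlists_appendI[of t n "Dom B" "rot t" n] by (simp add: mult_2)
  next
    fix w assume w: "w \<in> {w \<in> nlists (2 * n) (Dom B). ?H w \<and> ?J w}"
    then obtain t u where tu: "w = t @ u" "t \<in> nlists n (Dom B)" "u \<in> nlists n (Dom B)"
      using split by blast
    then have "t \<in> pols" "u = rot t"
      using w H[OF tu(2)] J[OF tu(2,3)] by auto
    then show "w \<in> concat ` Rel pol_digraph ()"
      unfolding pol_digraph_def tu(1) by (auto intro!: image_eqI[of _ _ "[t, rot t]"])
  qed
qed

text \<open>All conjunctions are finite: the signature is finite, and since \<open>es\<close> lists
  all \<open>a\<close>-tuples, so are the set of these tuples and each relation of the
  power.\<close>

lemma pp_definable_pol_digraph: "pp_definable B (2 * n) (concat ` Rel pol_digraph ())"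
  unfolding concat_Rel_pol_digraph
proof (rule pp_definable_conj)
  show "pp_definable B (2 * n) {w \<in> nlists (2 * n) (Dom B).
    \<forall>R\<in>Sym B. \<forall>T\<in>Rel (struct_power B a) R. map ((!) w) (map pos T) \<in> Rel B R}"
  proof (intro pp_definable_Ball pp_definable_atom finite_Sym finite_power_Rel)
    fix R T assume "R \<in> Sym B" "T \<in> Rel (struct_power B a) R"
    then have T: "T \<in> nlists (Ar B R) (nlists a (Dom B))"
      by simp
    then show "length (map pos T) = Ar B R"
      by simp
    show "set (map pos T) \<subseteq> {..<2 * n}"
      using pos_less[OF nlistsE_mem[OF T]] by (auto simp: mult_2 intro: trans_less_add1)
  qed (use n_pos in simp_all)
  show "pp_definable B (2 * n) {w \<in> nlists (2 * n) (Dom B).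
    \<forall>x\<in>nlists a (Dom B). w ! (n + pos x) = w ! pos (rotate1 x)}"
  proof (intro pp_definable_Ball pp_definable_equal)
    show "finite (nlists a (Dom B))"
      unfolding set_es[symmetric] by simp
    show "0 < 2 * n"
      using n_pos by simp
    fix x assume x: "x \<in> nlists a (Dom B)"
    show "n + pos x < 2 * n" "pos (rotate1 x) < 2 * n"
      using pos_less[OF x] pos_less[OF rotate1_in_nlists[OF x]] by simp_all
  qed
qed

lemma is_pp_power_pol_digraph: "is_pp_power B pol_digraph"
proof -
  have "isomorphic pol_digraph pol_digraph"
    by (auto simp: isomorphic_def same_signature_def intro!: exI[of _ id])
  moreover have "Sym pol_digraph = {()}" "Ar pol_digraph () = 2" "Dom pol_digraph = nlists n (Dom B)"
    by (simp_all add: pol_digraph_def)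
  ultimately show ?thesis
    unfolding is_pp_power_def using is_struct_pol_digraph pp_definable_pol_digraph n_pos
    by (intro exI[of _ n] conjI exI[of _ pol_digraph]) (auto simp: Suc_le_eq)
qed

section \<open>Homomorphisms between the cycle and the digraph of polymorphisms\<close>

text \<open>Projections are polymorphisms, and rotating the arguments of the \<open>i\<close>-th one
  gives the projection with index \<open>Suc i mod a\<close>.\<close>

lemma dicycle_hom_pol_digraph: "is_hom (dicycle a) pol_digraph (\<lambda>i. map (\<lambda>x. x ! i) es)"
proof -
  have proj: "map (\<lambda>x. x ! i) es \<in> pols" if "i < a" for i
    using map_in_pols[OF is_hom_projection[OF that]] .
  have "rot (map (\<lambda>x. x ! i) es) = map (\<lambda>x. x ! (Suc i mod a)) es" if "i < a" for i
    using that by (auto simp: rot_def set_es table_map rotate1_in_nlists nth_rotate1)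
  then have "[map (\<lambda>x. x ! i) es, map (\<lambda>x. x ! (Suc i mod a)) es] \<in> Rel pol_digraph ()"
    if "i < a" for i
    using proj[OF that] that unfolding pol_digraph_def by auto
  moreover have "map (\<lambda>x. x ! i) es \<in> Dom pol_digraph" if "i < a" for i
    using proj[OF that] by (simp only: pols_def pol_digraph_def mem_Collect_eq rel_struct.simps)
  ultimately show ?thesis
    unfolding is_hom_def same_signature_def by (auto simp: dicycle_def) (simp_all add: pol_digraph_def)
qed

text \<open>\<open>blow\<close> repeats each of the \<open>p\<close> entries \<open>m\<close> times,
  so \<open>f\<close> identifies the arguments of \<open>t\<close> in blocks. Rotating
  \<open>y\<close> once rotates \<open>blow y\<close> by \<open>m\<close>, and the function
  tabulated by \<open>t\<close> is invariant under that rotation.\<close>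

lemma fixed_polymorphism_imp_cyclic_loop:
  assumes t: "t \<in> pols" and fixed: "(rot ^^ m) t = t" and m: "p * m = a"
  shows "Pol_satisfies_cyclic_loop B p"
proof -
  have pos_m: "0 < m" "0 < p"
    using m a_pos by (auto intro: gr0I)
  define blow :: "'b list \<Rightarrow> 'b list" where "blow y = map (\<lambda>i. y ! (i div m)) [0..<a]" for y
  define f where "f y = t ! pos (blow y)" for y
  have blow: "is_hom (struct_power B p) (struct_power B a) blow"
    unfolding blow_def
    by (rule is_hom_reindex) (use m in \<open>simp add: less_mult_imp_div_less\<close>)
  have "is_hom (struct_power B p) B f"
    using is_hom_comp[OF blow, of B "\<lambda>x. t ! pos x"] t
    unfolding pols_def f_def comp_def by blast
  moreover have "f y = f (rotate1 y)" if y: "y \<in> nlists p (Dom B)" for y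
  proof -
    have blow_in: "blow y \<in> nlists a (Dom B)"
      using blow y by (auto simp: is_hom_def struct_power_def)
    have "f y = (rot ^^ m) t ! pos (blow y)"
      by (simp add: fixed f_def)
    also have "\<dots> = t ! pos (rotate m (blow y))"
      using t by (simp add: rot_power pols_def table_map[OF blow_in])
    also have "rotate m (blow y) = blow (rotate1 y)"
      unfolding blow_def using y m pos_m by (intro rotate_blocks[of _ p]) simp_all
    finally show ?thesis by (simp add: f_def)
  qed
  ultimately show ?thesis
    using pos_m unfolding Pol_satisfies_cyclic_loop_def Pol_def
    by (intro exI[of _ f]) (simp add: Suc_le_eq)
qed

text \<open>By assumption no table in \<open>pols\<close> is fixed by
  \<open>rot ^^ (a div p)\<close> for a prime \<open>p\<close> dividing \<open>a\<close>, so every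
  orbit of \<open>rot\<close> on \<open>pols\<close> has exactly \<open>a\<close> elements and can
  be labelled by the vertices of the cycle.\<close>

lemma pol_digraph_hom_dicycle:
  assumes "\<And>p. prime p \<Longrightarrow> p dvd a \<Longrightarrow> \<not> Pol_satisfies_cyclic_loop B p"
  shows "\<exists>g. is_hom pol_digraph (dicycle a) g"
proof -
  have per: "(rot ^^ a) t = t" if "t \<in> pols" for t
    using that rot_power_a by (simp add: pols_def)
  have "(rot ^^ k) t \<noteq> t" if t: "t \<in> pols" and k: "0 < k" "k < a" for t k
  proof (rule no_shorter_period[OF per[OF t] _ k])
    fix p assume p: "prime p" "p dvd a"
    then show "(rot ^^ (a div p)) t \<noteq> t"
      using fixed_polymorphism_imp_cyclic_loop[OF t, of "a div p" p] assms[OF p] by auto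
  qed
  then obtain g where g: "\<And>t. t \<in> pols \<Longrightarrow> g t < a \<and> g (rot t) = Suc (g t) mod a"
    using cyclic_labelling[of a pols rot] a_pos per rot_in_pols by metis
  \<comment> \<open>Vertices outside \<open>pols\<close> lie on no edge; they may all be sent to
    \<open>0\<close>, which is a vertex of the cycle since \<open>0 < a\<close>.\<close>
  have "is_hom pol_digraph (dicycle a) (\<lambda>t. if t \<in> pols then g t else 0)"
    using g rot_in_pols a_pos
    by (auto simp: is_hom_def same_signature_def dicycle_def pol_digraph_def)
  then show ?thesis by blast
qed

end

theorem corollary2p55:
  fixes a :: nat and B :: "('r, 'b) rel_struct"
  assumes "a \<ge> 1"
    and "is_struct B"
    and "finite (Dom B)"
    and "finite (Sym B)"
  shows "pp_constructs B (dicycle a) \<longleftrightarrow>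
    (\<forall>p. prime p \<and> p dvd a \<longrightarrow> \<not> Pol_satisfies_cyclic_loop B p)"
proof
  assume "pp_constructs B (dicycle a)"
  then show "\<forall>p. prime p \<and> p dvd a \<longrightarrow> \<not> Pol_satisfies_cyclic_loop B p"
    using cyclic_loop_imp_not_pp_constructs[of a _ B] prime_gt_1_nat assms(1) by auto
next
  assume no_loop: "\<forall>p. prime p \<and> p dvd a \<longrightarrow> \<not> Pol_satisfies_cyclic_loop B p"
  \<comment> \<open>Finiteness of the domain allows \<open>B\<^sup>a\<close> to be enumerated
    without repetition, so that functions on it become finite tables.\<close>
  have "finite (nlists a (Dom B))"
    using finite_lists_length_eq[OF assms(3), of a] unfolding nlists_def by (simp add: conj_commute)
  then obtain es where "set es = nlists a (Dom B)" "distinct es"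
    using finite_distinct_list by blast
  then interpret tuple_enumeration B a es
    by unfold_locales (use assms in auto)
  show "pp_constructs B (dicycle a)"
    unfolding pp_constructs_def hom_equivalent_def
    using is_struct_pol_digraph is_pp_power_pol_digraph dicycle_hom_pol_digraph
      pol_digraph_hom_dicycle no_loop by blast
qed

end
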